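(* Let $(T,\eta,\mu)$ be a monad on a category $\mathsf{C}$, let $(A,e)$ be a $T$-algebra, and suppose that the commutative square $$\begin{array}{ccc} TTTA & \xrightarrow{\;TTe\;} & TTA\\ {\scriptstyle \mu_{TA}}\downarrow & & \downarrow{\scriptstyle \mu_A}\\ TTA & \xrightarrow{\;Te\;} & TA\end{array}$$ is a weak pullback. Then for every object $S$ of $\mathsf{C}$ the partial evaluation relation on the set $\mathsf{C}(S,TA)$ is transitive.
   Context: A monad $(T,\eta,\mu)$ on $\mathsf{C}$ has unit $\eta:\mathrm{id}_{\mathsf{C}}\Rightarrow T$ and multiplication $\mu:TT\Rightarrow T$. A $T$-algebra is an object $A$ with a morphism $e:TA\to A$ such that $e\circ\eta_A=\mathrm{id}_A$ and $e\circ Te=e\circ\mu_A$. For morphisms $p,q:S\to TA$, a partial evaluation of $p$ into $q$ is a morphism $k:S\to TTA$ such that $\mu_A\circ k=p$ and $(Te)\circ k=q$. The partial evaluation relation on the set $\mathsf{C}(S,TA)$ of morphisms $S\to TA$ relates $p$ to $q$ if and only if there exists a partial evaluation of $p$ into $q$. A commuting square with $f:A'\to B$, $g:A'\to C$, $m:B\to D$, $n:C\to D$, $m\circ f=n\circ g$, is a weak pullback if for every object $S$ and all morphisms $b:S\to B$, $c:S\to C$ with $m\circ b=n\circ c$ there exists a (not necessarily unique) morphism $a:S\to A'$ with $f\circ a=b$ and $g\circ a=c$. *)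

theory Defs
  imports Main
begin

(* Objects are the elements of Obj and morphisms those of Arr; nothing is required of the
   operations outside these carriers, nor of Comp on non-composable pairs. *)
record ('o, 'm) category =
  Obj :: "'o set"
  Arr :: "'m set"
  Dom :: "'m \<Rightarrow> 'o"
  Cod :: "'m \<Rightarrow> 'o"
  Id :: "'o \<Rightarrow> 'm"
  Comp :: "'m \<Rightarrow> 'm \<Rightarrow> 'm" (infixl "\<cdot>\<index>" 70)

definition Hom :: "('o, 'm) category \<Rightarrow> 'o \<Rightarrow> 'o \<Rightarrow> 'm set" where
  "Hom C X Y = {f \<in> Arr C. Dom C f = X \<and> Cod C f = Y}"

locale is_category =
  fixes C :: "('o, 'm) category" (structure)
  assumes dom_obj: "f \<in> Arr C \<Longrightarrow> Dom C f \<in> Obj C"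
    and cod_obj: "f \<in> Arr C \<Longrightarrow> Cod C f \<in> Obj C"
    and id_hom: "X \<in> Obj C \<Longrightarrow> Id C X \<in> Hom C X X"
    and comp_hom: "\<lbrakk>f \<in> Hom C X Y; g \<in> Hom C Y Z\<rbrakk> \<Longrightarrow> g \<cdot> f \<in> Hom C X Z"
    and comp_id_right: "f \<in> Hom C X Y \<Longrightarrow> f \<cdot> Id C X = f"
    and comp_id_left: "f \<in> Hom C X Y \<Longrightarrow> Id C Y \<cdot> f = f"
    and comp_assoc:
      "\<lbrakk>f \<in> Hom C W X; g \<in> Hom C X Y; h \<in> Hom C Y Z\<rbrakk> \<Longrightarrow> (h \<cdot> g) \<cdot> f = h \<cdot> (g \<cdot> f)"

record ('o, 'm, 'p, 'n) fnctr =
  fobj :: "'o \<Rightarrow> 'p"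
  fmap :: "'m \<Rightarrow> 'n"

definition id_functor :: "('o, 'm, 'o, 'm) fnctr" where
  "id_functor = \<lparr>fobj = (\<lambda>X. X), fmap = (\<lambda>f. f)\<rparr>"

definition comp_functor ::
    "('p, 'n, 'q, 'l) fnctr \<Rightarrow> ('o, 'm, 'p, 'n) fnctr \<Rightarrow> ('o, 'm, 'q, 'l) fnctr" where
  "comp_functor G F = \<lparr>fobj = fobj G \<circ> fobj F, fmap = fmap G \<circ> fmap F\<rparr>"

locale is_functor = C: is_category C + D: is_category D
  for C :: "('o, 'm) category" and D :: "('p, 'n) category" +
  fixes F :: "('o, 'm, 'p, 'n) fnctr"
  assumes fobj_obj: "X \<in> Obj C \<Longrightarrow> fobj F X \<in> Obj D"
    and fmap_hom: "f \<in> Hom C X Y \<Longrightarrow> fmap F f \<in> Hom D (fobj F X) (fobj F Y)"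
    and fmap_id: "X \<in> Obj C \<Longrightarrow> fmap F (Id C X) = Id D (fobj F X)"
    and fmap_comp:
      "\<lbrakk>f \<in> Hom C X Y; g \<in> Hom C Y Z\<rbrakk> \<Longrightarrow> fmap F (g \<cdot>\<^bsub>C\<^esub> f) = fmap F g \<cdot>\<^bsub>D\<^esub> fmap F f"

locale natural_transformation = F: is_functor C D F + G: is_functor C D G
  for C :: "('o, 'm) category" and D :: "('p, 'n) category"
    and F :: "('o, 'm, 'p, 'n) fnctr" and G :: "('o, 'm, 'p, 'n) fnctr" +
  fixes \<tau> :: "'o \<Rightarrow> 'n"
  assumes component_hom: "X \<in> Obj C \<Longrightarrow> \<tau> X \<in> Hom D (fobj F X) (fobj G X)"
    and naturality: "f \<in> Hom C X Y \<Longrightarrow> \<tau> Y \<cdot>\<^bsub>D\<^esub> fmap F f = fmap G f \<cdot>\<^bsub>D\<^esub> \<tau> X"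

locale is_monad = T: is_functor C C T
    + unit: natural_transformation C C id_functor T \<eta>
    + mult: natural_transformation C C "comp_functor T T" T \<mu>
  for C :: "('o, 'm) category" (structure) and T :: "('o, 'm, 'o, 'm) fnctr"
    and \<eta> :: "'o \<Rightarrow> 'm" and \<mu> :: "'o \<Rightarrow> 'm" +
  assumes unit_left: "X \<in> Obj C \<Longrightarrow> \<mu> X \<cdot> \<eta> (fobj T X) = Id C (fobj T X)"
    and unit_right: "X \<in> Obj C \<Longrightarrow> \<mu> X \<cdot> fmap T (\<eta> X) = Id C (fobj T X)"
    and mult_assoc: "X \<in> Obj C \<Longrightarrow> \<mu> X \<cdot> \<mu> (fobj T X) = \<mu> X \<cdot> fmap T (\<mu> X)"

locale is_algebra = is_monad C T \<eta> \<mu>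
  for C :: "('o, 'm) category" (structure) and T :: "('o, 'm, 'o, 'm) fnctr"
    and \<eta> :: "'o \<Rightarrow> 'm" and \<mu> :: "'o \<Rightarrow> 'm" +
  fixes A :: 'o and e :: 'm
  assumes alg_obj: "A \<in> Obj C"
    and alg_hom: "e \<in> Hom C (fobj T A) A"
    and alg_unit: "e \<cdot> \<eta> A = Id C A"
    and alg_mult: "e \<cdot> fmap T e = e \<cdot> \<mu> A"

(* f : P -> X, g : P -> Y, m : X -> D, n : Y -> D *)
definition commuting_square :: "('o, 'm) category \<Rightarrow> 'm \<Rightarrow> 'm \<Rightarrow> 'm \<Rightarrow> 'm \<Rightarrow> bool" where
  "commuting_square C f g m n \<longleftrightarrow>
    (\<exists>P X Y D. f \<in> Hom C P X \<and> g \<in> Hom C P Y \<and> m \<in> Hom C X D \<and> n \<in> Hom C Y D) \<and>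
    m \<cdot>\<^bsub>C\<^esub> f = n \<cdot>\<^bsub>C\<^esub> g"

definition weak_pullback :: "('o, 'm) category \<Rightarrow> 'm \<Rightarrow> 'm \<Rightarrow> 'm \<Rightarrow> 'm \<Rightarrow> bool" where
  "weak_pullback C f g m n \<longleftrightarrow> commuting_square C f g m n \<and>
    (\<forall>S \<in> Obj C. \<forall>b \<in> Hom C S (Dom C m). \<forall>c \<in> Hom C S (Dom C n).
      m \<cdot>\<^bsub>C\<^esub> b = n \<cdot>\<^bsub>C\<^esub> c \<longrightarrow>
      (\<exists>a \<in> Hom C S (Dom C f). f \<cdot>\<^bsub>C\<^esub> a = b \<and> g \<cdot>\<^bsub>C\<^esub> a = c))"

definition partial_evaluation ::
    "('o, 'm) category \<Rightarrow> ('o, 'm, 'o, 'm) fnctr \<Rightarrow> ('o \<Rightarrow> 'm) \<Rightarrow> 'o \<Rightarrow> 'm \<Rightarrow> 'o \<Rightarrow>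
      'm \<Rightarrow> 'm \<Rightarrow> 'm \<Rightarrow> bool" where
  "partial_evaluation C T \<mu> A e S k p q \<longleftrightarrow>
    k \<in> Hom C S (fobj T (fobj T A)) \<and> \<mu> A \<cdot>\<^bsub>C\<^esub> k = p \<and> fmap T e \<cdot>\<^bsub>C\<^esub> k = q"

definition partial_evaluation_rel ::
    "('o, 'm) category \<Rightarrow> ('o, 'm, 'o, 'm) fnctr \<Rightarrow> ('o \<Rightarrow> 'm) \<Rightarrow> 'o \<Rightarrow> 'm \<Rightarrow> 'o \<Rightarrow> 'm rel" where
  "partial_evaluation_rel C T \<mu> A e S =
    {(p, q). p \<in> Hom C S (fobj T A) \<and> q \<in> Hom C S (fobj T A) \<and>
      (\<exists>k. partial_evaluation C T \<mu> A e S k p q)}"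

end

theory Submission
  imports Defs
begin

text \<open>
  Let \<open>k\<close> partially evaluate \<open>p\<close> into \<open>q\<close> and \<open>l\<close> partially evaluate \<open>q\<close> into \<open>r\<close>. Then
  \<open>Te \<circ> k = q = \<mu>\<^sub>A \<circ> l\<close>, so \<open>l\<close> and \<open>k\<close> form a cone over the cospan of the square, and the weak
  pullback property yields \<open>a : S \<rightarrow> TTTA\<close> with \<open>TTe \<circ> a = l\<close> and \<open>\<mu>\<^bsub>TA\<^esub> \<circ> a = k\<close>. Think of \<open>a\<close> as a
  triply nested formal expression: evaluating the innermost level gives \<open>l\<close>, flattening the two
  outer levels gives \<open>k\<close>. Flattening the two inner levels instead, that is, taking
  \<open>T\<mu>\<^sub>A \<circ> a\<close>, composes the two partial evaluations: its total flattening agrees with that of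
  \<open>k\<close> by associativity of \<open>\<mu>\<close>, and its evaluation agrees with that of \<open>l\<close> because
  \<open>e \<circ> \<mu>\<^sub>A = e \<circ> Te\<close>.
\<close>

text \<open>
  The composition step holds for an arbitrary morphism \<open>a : S \<rightarrow> TTTA\<close>; the weak pullback
  property then supplies an \<open>a\<close> whose two images are the given partial evaluations.
\<close>

lemma (in is_algebra) partial_evaluation_of_nested:
  assumes a: "a \<in> Hom C S (fobj T (fobj T (fobj T A)))"
  shows "partial_evaluation C T \<mu> A e S (fmap T (\<mu> A) \<cdot> a)
    (\<mu> A \<cdot> (\<mu> (fobj T A) \<cdot> a)) (fmap T e \<cdot> (fmap T (fmap T e) \<cdot> a))"
proof -
  have TA: "fobj T A \<in> Obj C"
    using alg_obj by (rule T.fobj_obj)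
  have mu: "\<mu> X \<in> Hom C (fobj T (fobj T X)) (fobj T X)" if "X \<in> Obj C" for X
    using mult.component_hom[OF that] by (simp add: comp_functor_def)
  note muA = mu[OF alg_obj]
  note muTA = mu[OF TA]
  note Te = T.fmap_hom[OF alg_hom]
  note TTe = T.fmap_hom[OF Te]
  note TmuA = T.fmap_hom[OF muA]
  have "\<mu> A \<cdot> (fmap T (\<mu> A) \<cdot> a) = (\<mu> A \<cdot> fmap T (\<mu> A)) \<cdot> a"
    using T.C.comp_assoc[OF a TmuA muA] by simp
  also have "\<dots> = (\<mu> A \<cdot> \<mu> (fobj T A)) \<cdot> a"
    using mult_assoc[OF alg_obj] by simp
  also have "\<dots> = \<mu> A \<cdot> (\<mu> (fobj T A) \<cdot> a)"
    by (rule T.C.comp_assoc[OF a muTA muA])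
  finally have flatten: "\<mu> A \<cdot> (fmap T (\<mu> A) \<cdot> a) = \<mu> A \<cdot> (\<mu> (fobj T A) \<cdot> a)" .
  have "fmap T e \<cdot> (fmap T (\<mu> A) \<cdot> a) = fmap T (e \<cdot> \<mu> A) \<cdot> a"
    using T.C.comp_assoc[OF a TmuA Te] T.fmap_comp[OF muA alg_hom] by simp
  also have "\<dots> = fmap T (e \<cdot> fmap T e) \<cdot> a"
    by (simp add: alg_mult)
  also have "\<dots> = fmap T e \<cdot> (fmap T (fmap T e) \<cdot> a)"
    using T.C.comp_assoc[OF a TTe Te] T.fmap_comp[OF Te alg_hom] by simp
  finally have evaluate:
    "fmap T e \<cdot> (fmap T (\<mu> A) \<cdot> a) = fmap T e \<cdot> (fmap T (fmap T e) \<cdot> a)" .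
  show ?thesis
    using T.C.comp_hom[OF a TmuA] flatten evaluate by (simp add: partial_evaluation_def)
qed

theorem proposition2p12:
  fixes C :: "('o, 'm) category" and T :: "('o, 'm, 'o, 'm) fnctr"
    and \<eta> \<mu> :: "'o \<Rightarrow> 'm" and A :: 'o and e :: 'm
  assumes "is_category C"
    and "is_monad C T \<eta> \<mu>"
    and "is_algebra C T \<eta> \<mu> A e"
    and "weak_pullback C (fmap T (fmap T e)) (\<mu> (fobj T A)) (\<mu> A) (fmap T e)"
  shows "\<forall>S \<in> Obj C. trans_on (Hom C S (fobj T A)) (partial_evaluation_rel C T \<mu> A e S)"
proof (intro ballI trans_onI)
  fix S p q r
  assume S: "S \<in> Obj C"
    and p: "p \<in> Hom C S (fobj T A)" and r: "r \<in> Hom C S (fobj T A)"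
    and pq: "(p, q) \<in> partial_evaluation_rel C T \<mu> A e S"
    and qr: "(q, r) \<in> partial_evaluation_rel C T \<mu> A e S"
  interpret is_algebra C T \<eta> \<mu> A e by fact
  have doms: "Dom C (\<mu> A) = fobj T (fobj T A)" "Dom C (fmap T e) = fobj T (fobj T A)"
    "Dom C (fmap T (fmap T e)) = fobj T (fobj T (fobj T A))"
    using mult.component_hom[OF alg_obj] T.fmap_hom[OF alg_hom]
      T.fmap_hom[OF T.fmap_hom[OF alg_hom]]
    by (simp_all add: Hom_def comp_functor_def)
  obtain k where k: "k \<in> Hom C S (fobj T (fobj T A))"
      "\<mu> A \<cdot>\<^bsub>C\<^esub> k = p" "fmap T e \<cdot>\<^bsub>C\<^esub> k = q"
    using pq by (auto simp: partial_evaluation_rel_def partial_evaluation_def)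
  obtain l where l: "l \<in> Hom C S (fobj T (fobj T A))"
      "\<mu> A \<cdot>\<^bsub>C\<^esub> l = q" "fmap T e \<cdot>\<^bsub>C\<^esub> l = r"
    using qr by (auto simp: partial_evaluation_rel_def partial_evaluation_def)
  have "\<mu> A \<cdot>\<^bsub>C\<^esub> l = fmap T e \<cdot>\<^bsub>C\<^esub> k"
    using k l by simp
  then obtain a where a: "a \<in> Hom C S (fobj T (fobj T (fobj T A)))"
      "fmap T (fmap T e) \<cdot>\<^bsub>C\<^esub> a = l" "\<mu> (fobj T A) \<cdot>\<^bsub>C\<^esub> a = k"
    using assms(4) S k(1) l(1) unfolding weak_pullback_def doms by blast
  have "partial_evaluation C T \<mu> A e S (fmap T (\<mu> A) \<cdot>\<^bsub>C\<^esub> a) p r"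
    using partial_evaluation_of_nested[OF a(1)] a k l by simp
  then show "(p, r) \<in> partial_evaluation_rel C T \<mu> A e S"
    using p r by (auto simp: partial_evaluation_rel_def)
qed

end
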